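(* Let $m$ be a nonnegative integer and let $G$ be a graph on $n=|V(G)|$ vertices that has at least $m+1$ independent edges. Then the $(n-m)$-dominating graph $D_{n-m}(G)$ is connected.
   Context: All graphs are finite, simple and undirected. A set $S\subseteq V(G)$ is a dominating set of $G$ if every vertex of $V(G)\setminus S$ is adjacent to a vertex of $S$. A set of edges is independent if no two of them share an endpoint. For a positive integer $k$, the $k$-dominating graph $D_k(G)$ is the graph whose vertices are the dominating sets of $G$ of cardinality at most $k$, where two such sets $A,B$ are adjacent if and only if their symmetric difference $(A\setminus B)\cup(B\setminus A)$ consists of exactly one vertex of $G$. *)

theory Defs
  imports "Graph_Theory.Digraph_Component"
begin

text \<open>
  Finite simple undirected graphs are the symmetric, loop-free digraphs without parallel arcs of
  locale \<^locale>\<open>graph\<close>: the undirected edge between \<open>u\<close> and \<open>v\<close> is the pair of arcs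
  \<open>u \<rightarrow> v\<close> and \<open>v \<rightarrow> u\<close>. Edges are counted as unordered pairs, so each such pair of arcs is
  one edge.
\<close>

definition edge_set :: "('a, 'b) pre_digraph \<Rightarrow> 'a set set" where
  "edge_set G = {{u, v} | u v. u \<rightarrow>\<^bsub>G\<^esub> v}"

definition independent_edges :: "('a, 'b) pre_digraph \<Rightarrow> 'a set set \<Rightarrow> bool" where
  "independent_edges G M \<longleftrightarrow> M \<subseteq> edge_set G \<and> pairwise disjnt M"

definition dominating_set :: "('a, 'b) pre_digraph \<Rightarrow> 'a set \<Rightarrow> bool" where
  "dominating_set G S \<longleftrightarrow>
     S \<subseteq> verts G \<and> (\<forall>v \<in> verts G - S. \<exists>u \<in> S. v \<rightarrow>\<^bsub>G\<^esub> u)"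

definition k_dominating_graph :: "nat \<Rightarrow> ('a, 'b) pre_digraph \<Rightarrow> 'a set pair_pre_digraph" where
  "k_dominating_graph k G =
     \<lparr> pverts = {S. dominating_set G S \<and> card S \<le> k},
       parcs = {(A, B). dominating_set G A \<and> card A \<le> k \<and> dominating_set G B \<and> card B \<le> k
                  \<and> card ((A - B) \<union> (B - A)) = 1} \<rparr>"

lemma pair_graph_k_dominating_graph:
  assumes "graph G"
  shows "pair_graph (k_dominating_graph k G)"
proof -
  interpret graph G by fact
  let ?P = "{S. dominating_set G S \<and> card S \<le> k}"
  have fin: "finite ?P"
    by (rule finite_subset[of _ "Pow (verts G)"]) (auto simp: dominating_set_def)
  have "finite (parcs (k_dominating_graph k G))"
    by (rule finite_subset[of _ "?P \<times> ?P"]) (auto simp: fin k_dominating_graph_def)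
  moreover have "symmetric (k_dominating_graph k G)"
    by (auto simp: symmetric_def sym_def k_dominating_graph_def Un_commute)
  ultimately show ?thesis
    using fin by unfold_locales (auto simp: k_dominating_graph_def)
qed

end

theory Submission
  imports Defs
begin

text \<open>
  Call a matching edge doubled in \<open>S\<close> if \<open>S\<close> contains both of its endpoints. A dominating set
  without doubled edges can be moved to the complement of any fixed transversal of the matching by
  adding the missing vertices and then trading one endpoint for the other, edge by edge. If there
  are doubled edges, shrink \<open>S\<close> to a minimal dominating set. Then every endpoint \<open>u\<close> of a doubled
  edge has private neighbours outside \<open>S\<close>, and averaging shows that for some such \<open>u\<close> they all
  fit into \<open>S\<close> without exceeding the size bound. After adding an inclusion-maximal set
  of them containing no matching edge, \<open>u\<close> can be removed: each private neighbour left out is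
  matched to one that was added. No new doubled edge arises.
\<close>

section \<open>Reconfiguration of dominating sets\<close>

text \<open>Reachability is reflexive only on vertices of the digraph, so
  \<open>reconf G k A A\<close> requires \<open>A\<close> to be dominating and of size at most
  \<open>k\<close>.\<close>

abbreviation reconf :: "('a, 'b) pre_digraph \<Rightarrow> nat \<Rightarrow> 'a set \<Rightarrow> 'a set \<Rightarrow> bool" where
  "reconf G k A B \<equiv> A \<rightarrow>\<^sup>*\<^bsub>with_proj (k_dominating_graph k G)\<^esub> B"

text \<open>The external private neighbourhood of domination theory: apart from \<open>u\<close>
  itself, exactly these vertices lose their domination when \<open>u\<close> leaves a dominating set
  \<open>S\<close>.\<close>

definition private_nbrs :: "('a, 'b) pre_digraph \<Rightarrow> 'a set \<Rightarrow> 'a \<Rightarrow> 'a set" where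
  "private_nbrs G S u = {v \<in> verts G - S. v \<rightarrow>\<^bsub>G\<^esub> u \<and> (\<forall>x\<in>S. v \<rightarrow>\<^bsub>G\<^esub> x \<longrightarrow> x = u)}"

text \<open>\<open>connected\<close> is strong connectivity of the symmetric closure, and closing a
  symmetric digraph leaves reachability unchanged.\<close>

lemma (in wf_digraph) strongly_connected_imp_connected:
  assumes "symmetric G" "strongly_connected G"
  shows "connected G"
  using assms(2) reachable_mk_symmetric_eq[OF assms(1)]
  unfolding connected_def strongly_connected_def by (simp add: mk_symmetric_def)

context graph
begin

lemma finite_subset_verts: "S \<subseteq> verts G \<Longrightarrow> finite S"
  using finite_verts finite_subset by blast

lemma reconf_trans: "reconf G k A B \<Longrightarrow> reconf G k B C \<Longrightarrow> reconf G k A C"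
proof -
  interpret D: pair_graph "k_dominating_graph k G"
    by (rule pair_graph_k_dominating_graph) (rule graph_axioms)
  show "reconf G k A B \<Longrightarrow> reconf G k B C \<Longrightarrow> reconf G k A C"
    by (rule D.reachable_trans)
qed

lemma reconf_sym: "reconf G k A B \<Longrightarrow> reconf G k B A"
proof -
  interpret D: pair_graph "k_dominating_graph k G"
    by (rule pair_graph_k_dominating_graph) (rule graph_axioms)
  show "reconf G k A B \<Longrightarrow> reconf G k B A"
    by (rule symmetric_reachable[OF D.sym_arcs])
qed

lemma reconf_refl: "dominating_set G A \<Longrightarrow> card A \<le> k \<Longrightarrow> reconf G k A A"
  by (auto simp: reachable_def k_dominating_graph_def intro: rtrancl_on_refl)

lemma dominating_set_mono:
  "dominating_set G S \<Longrightarrow> S \<subseteq> T \<Longrightarrow> T \<subseteq> verts G \<Longrightarrow> dominating_set G T"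
  unfolding dominating_set_def by blast

lemma reconf_insert:
  assumes "dominating_set G S" "x \<in> verts G" "card (insert x S) \<le> k"
  shows "reconf G k S (insert x S)"
proof (cases "x \<in> S")
  case True
  then show ?thesis using assms by (simp add: insert_absorb reconf_refl)
next
  case False
  interpret D: pair_graph "k_dominating_graph k G"
    by (rule pair_graph_k_dominating_graph) (rule graph_axioms)
  have sub: "S \<subseteq> verts G" using assms(1) by (simp add: dominating_set_def)
  then have "finite S" by (rule finite_subset_verts)
  then have "card S \<le> k" using assms(3) False by simp
  moreover have "dominating_set G (insert x S)"
    using dominating_set_mono[OF assms(1), of "insert x S"] sub assms(2) by auto
  moreover have "S - insert x S \<union> (insert x S - S) = {x}" using False by auto
  ultimately have "(S, insert x S) \<in> parcs (k_dominating_graph k G)"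
    using assms by (simp add: k_dominating_graph_def)
  then show ?thesis by (intro D.reachable_adjI) simp
qed

text \<open>Add the vertices of \<open>T\<close> one at a time: each intermediate set contains
  \<open>S\<close>, hence dominates, and lies in \<open>T\<close>, hence is small enough.\<close>

lemma reconf_superset:
  assumes "dominating_set G S" "S \<subseteq> T" "T \<subseteq> verts G" "card T \<le> k"
  shows "reconf G k S T"
proof -
  have finT: "finite T" using assms(3) by (rule finite_subset_verts)
  have "reconf G k S (S \<union> X)" if "X \<subseteq> T" for X
  proof -
    have "finite X" using that finT by (rule finite_subset)
    then show ?thesis using that
    proof (induction X)
      case empty
      have "card S \<le> k" using card_mono[OF finT assms(2)] assms(4) by simp
      then show ?case using assms by (simp add: reconf_refl)
    next
      case (insert x X)
      have le: "insert x (S \<union> X) \<subseteq> T" using insert assms by auto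
      have "dominating_set G (S \<union> X)"
        using dominating_set_mono[OF assms(1)] le assms(3) by blast
      moreover have "card (insert x (S \<union> X)) \<le> k"
        using card_mono[OF finT le] assms(4) by simp
      ultimately have "reconf G k (S \<union> X) (insert x (S \<union> X))"
        using le assms(3) by (intro reconf_insert) auto
      then show ?case using insert reconf_trans by (metis Un_insert_right insert_subset)
    qed
  qed
  from this[of T] show ?thesis using assms(2) by (simp add: Un_absorb1)
qed

text \<open>Some vertex is undominated once \<open>u\<close> is removed. It is not \<open>u\<close>,
  which still has the neighbour \<open>w\<close>, so it lies outside \<open>S\<close>.\<close>

lemma private_nbrs_nonempty:
  assumes "dominating_set G S" "\<not> dominating_set G (S - {u})" "w \<in> S" "w \<noteq> u" "u \<rightarrow> w"
  shows "private_nbrs G S u \<noteq> {}"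
  using assms unfolding private_nbrs_def dominating_set_def by blast

end

section \<open>Matchings and doubled edges\<close>

locale matched_graph = graph G for G :: "('a, 'b) pre_digraph" (structure) +
  fixes M :: "'a set set"
  assumes indep: "independent_edges G M"
begin

definition doubled :: "'a set \<Rightarrow> 'a set set" where
  "doubled S = {e \<in> M. e \<subseteq> S}"

lemma matching_edgeE:
  assumes "e \<in> M" "u \<in> e"
  obtains w where "e = {u, w}" "u \<noteq> w" "u \<rightarrow> w" "w \<rightarrow> u" "u \<in> verts G" "w \<in> verts G"
proof -
  from assms(1) indep obtain x y where xy: "e = {x, y}" "x \<rightarrow> y"
    unfolding independent_edges_def edge_set_def by blast
  have "y \<rightarrow> x" using xy(2) by (rule graph_symmetric)
  moreover have "x \<noteq> y" using xy(2) adj_not_same by blast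
  moreover have "x \<in> verts G" "y \<in> verts G" using xy(2) adj_in_verts by auto
  ultimately show thesis using that xy assms(2) by blast
qed

lemma matching_unique: "e \<in> M \<Longrightarrow> e' \<in> M \<Longrightarrow> x \<in> e \<Longrightarrow> x \<in> e' \<Longrightarrow> e = e'"
  using indep unfolding independent_edges_def pairwise_def disjnt_def by blast

lemma edge_nonempty: "e \<in> M \<Longrightarrow> e \<noteq> {}"
  using indep unfolding independent_edges_def edge_set_def by blast

lemma card_edge: "e \<in> M \<Longrightarrow> card e = 2"
  using edge_nonempty[of e] by (metis ex_in_conv card_2_iff matching_edgeE)

lemma edge_subset_verts: "e \<in> M \<Longrightarrow> e \<subseteq> verts G"
  using matching_edgeE by blast

lemma finite_edge: "e \<in> M \<Longrightarrow> finite e"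
  using edge_subset_verts finite_subset_verts by blast

lemma finite_matching: "finite M"
  by (rule finite_subset[of _ "Pow (verts G)"]) (use edge_subset_verts in auto)

lemma doubled_mono: "S \<subseteq> T \<Longrightarrow> doubled S \<subseteq> doubled T"
  unfolding doubled_def by blast

lemma finite_doubled: "finite (doubled S)"
  using finite_matching by (simp add: doubled_def)

text \<open>Every matching edge has an endpoint outside \<open>S\<close>, and disjointness makes
  these endpoints distinct.\<close>

lemma card_if_not_doubled:
  assumes "S \<subseteq> verts G" "doubled S = {}"
  shows "card S + card M \<le> card (verts G)"
proof -
  have "\<forall>e\<in>M. \<exists>x. x \<in> e - S" using assms(2) unfolding doubled_def by blast
  then obtain f where f: "\<forall>e\<in>M. f e \<in> e - S" by metis
  then have "inj_on f M" by (intro inj_onI) (metis DiffD1 matching_unique)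
  then have "card M = card (f ` M)" by (simp add: card_image)
  also have "\<dots> \<le> card (verts G - S)"
    using f edge_subset_verts by (intro card_mono) auto
  also have "\<dots> = card (verts G) - card S"
    using assms(1) finite_subset_verts by (intro card_Diff_subset) auto
  finally show ?thesis using card_mono[OF finite_verts assms(1)] by linarith
qed

section \<open>Sets without doubled edges\<close>

text \<open>Induction on the number of vertices of \<open>T\<close> still in \<open>S\<close>. By
  \<open>k\<close>, a set without doubled edges has at most \<open>k - 1\<close> vertices, which
  leaves room for one extra vertex during a trade.\<close>

lemma reconf_to_transversal_complement_if_not_doubled:
  assumes "dominating_set G S" "doubled S = {}"
    and T: "T \<subseteq> \<Union>M" "\<And>e. e \<in> M \<Longrightarrow> \<exists>!x. x \<in> e \<inter> T"
    and k: "card (verts G) + 1 \<le> k + card M"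
  shows "reconf G k S (verts G - T)"
  using assms(1,2)
proof (induction "card (T \<inter> S)" arbitrary: S rule: less_induct)
  case less
  have SV: "S \<subseteq> verts G" using less.prems by (simp add: dominating_set_def)
  have TV: "T \<subseteq> verts G" using T(1) edge_subset_verts by blast
  show ?case
  proof (cases "T \<inter> S = {}")
    case True
    have "doubled (verts G - T) = {}" using T(2) unfolding doubled_def by blast
    from card_if_not_doubled[OF _ this] have "card (verts G - T) \<le> k" using k by simp
    then show ?thesis using True SV less.prems by (intro reconf_superset) auto
  next
    case False
    then obtain u where u: "u \<in> T" "u \<in> S" by blast
    then obtain e where e: "e \<in> M" "u \<in> e" using T(1) by blast
    then obtain w where w: "e = {u, w}" "u \<noteq> w" "u \<rightarrow> w" "w \<rightarrow> u" "w \<in> verts G"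
      by (metis matching_edgeE)
    have wS: "w \<notin> S" using less.prems(2) e w u unfolding doubled_def by blast
    have wT: "w \<notin> T" using T(2)[OF e(1)] w u by blast
    \<comment> \<open>\<open>S1\<close> consists of all unmatched vertices and exactly one endpoint
      of each matching edge: the one in \<open>S\<close> if there is one, otherwise the one outside
      \<open>T\<close>. \<open>S2\<close> differs from it only on \<open>e\<close>, where
      \<open>w\<close> replaces \<open>u\<close>.\<close>
    define S1 where "S1 = S \<union> {v \<in> verts G - T. \<forall>e\<in>M. v \<in> e \<longrightarrow> e \<inter> S = {}}"
    define S2 where "S2 = insert w S1 - {u}"
    have S1V: "S1 \<subseteq> verts G" using SV unfolding S1_def by blast
    have d1: "doubled S1 = {}"
    proof (rule ccontr)
      assume "doubled S1 \<noteq> {}"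
      then obtain f where f: "f \<in> M" "f \<subseteq> S1" unfolding doubled_def by blast
      \<comment> \<open>Vertices added to \<open>S\<close> avoid \<open>T\<close>, so
        \<open>x\<close> comes from \<open>S\<close>; then \<open>f\<close> meets \<open>S\<close>
        and nothing of \<open>f\<close> was added.\<close>
      obtain x where x: "x \<in> f" "x \<in> T" using T(2)[OF f(1)] by blast
      then have "x \<in> S" using f unfolding S1_def by blast
      then have "f \<subseteq> S" using f x unfolding S1_def by blast
      then show False using less.prems(2) f unfolding doubled_def by blast
    qed
    \<comment> \<open>Both endpoints of \<open>e\<close> are present for a moment; the spare place
      pays for \<open>w\<close>.\<close>
    have "card (insert w S1) \<le> Suc (card S1)" by (rule card_insert_le_m1) auto
    then have c: "card (insert w S1) \<le> k" using card_if_not_doubled[OF S1V d1] k by linarith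
    have d2: "doubled S2 = {}"
    proof (rule ccontr)
      assume "doubled S2 \<noteq> {}"
      then obtain f where f: "f \<in> M" "f \<subseteq> S2" unfolding doubled_def by blast
      have "w \<in> f" using d1 f unfolding S2_def doubled_def by blast
      then have "f = e" using matching_unique f e w by blast
      then show False using f e unfolding S2_def by blast
    qed
    \<comment> \<open>Every vertex missing from \<open>S2\<close> is matched, and its partner along
      the matching edge lies in \<open>S2\<close>.\<close>
    have dom: "dominating_set G S2"
      unfolding dominating_set_def
    proof (intro conjI ballI)
      show "S2 \<subseteq> verts G" using S1V w unfolding S2_def by blast
      fix v assume v: "v \<in> verts G - S2"
      show "\<exists>u\<in>S2. v \<rightarrow> u"
      proof (cases "v = u")
        case True
        then show ?thesis using w unfolding S2_def by blast
      next
        case vu: False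
        then have vS: "v \<notin> S1" "v \<noteq> w" "v \<notin> S" using v unfolding S2_def S1_def by auto
        have "\<exists>f\<in>M. v \<in> f" using vS(1) v T(1) unfolding S1_def by blast
        then obtain f where f: "f \<in> M" "v \<in> f" by blast
        then obtain v' where v': "f = {v, v'}" "v \<noteq> v'" "v \<rightarrow> v'" "v' \<in> verts G"
          by (metis matching_edgeE)
        have "v' \<noteq> u" using matching_unique[OF f(1) e(1), of u] v' e w vS vu by blast
        moreover have "v' \<in> S1"
        proof (cases "f \<inter> S = {}")
          case True
          then have "v \<in> T" using vS(1) v f matching_unique unfolding S1_def by blast
          then have "v' \<notin> T" using T(2)[OF f(1)] v' by blast
          then show ?thesis using True v' f matching_unique unfolding S1_def by blast
        next
          case False
          then show ?thesis using v' vS unfolding S1_def by blast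
        qed
        ultimately show ?thesis using v' unfolding S2_def by blast
      qed
    qed
    have "T \<inter> S2 \<subset> T \<inter> S" using u wT unfolding S2_def S1_def by blast
    moreover have "finite (T \<inter> S)" using SV finite_subset_verts by blast
    ultimately have "card (T \<inter> S2) < card (T \<inter> S)" by (simp add: psubset_card_mono)
    then have "reconf G k S2 (verts G - T)" using less.hyps dom d2 by blast
    \<comment> \<open>\<open>S\<close> and \<open>S2\<close> have the common superset
      \<open>insert w S1\<close>: climb to it from \<open>S\<close>, then descend to
      \<open>S2\<close>.\<close>
    moreover have "reconf G k S (insert w S1)"
      using less.prems c S1V w by (intro reconf_superset) (auto simp: S1_def)
    moreover have "reconf G k S2 (insert w S1)"
      using dom c S1V w by (intro reconf_superset) (auto simp: S2_def)
    ultimately show ?thesis using reconf_trans reconf_sym by meson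
  qed
qed

section \<open>Reducing the number of doubled edges\<close>

text \<open>Let \<open>p\<close> be the least number of private neighbours of an endpoint of a
  doubled edge. Double counting gives \<open>card C \<ge> card N + card E * p\<close>, which is at
  least \<open>card M + p - 1\<close>; an endpoint attaining \<open>p\<close> then works.\<close>

lemma ex_few_private_nbrs:
  assumes dom: "dominating_set G S"
    and min: "\<And>u. u \<in> S \<Longrightarrow> \<not> dominating_set G (S - {u})"
    and ne: "doubled S \<noteq> {}"
  shows "\<exists>u\<in>\<Union>(doubled S). card S + card (private_nbrs G S u) + card M \<le> card (verts G) + 1"
proof -
  define E where "E = doubled S"
  define N where "N = M - E"
  define C where "C = verts G - S"
  define P where "P = private_nbrs G S"
  define Q where "Q = (\<Union>u\<in>\<Union>E. P u)"
  \<comment> \<open>With these weights every matching edge that is not doubled weighs at least 2 inside \<open>C\<close>, since a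
    vertex of \<open>Q\<close> is matched either into \<open>C\<close> or to the doubled endpoint it is private to, which is
    impossible.\<close>
  define f where "f v = (if v \<in> Q then 1 else 2 :: nat)" for v
  have EM: "E \<subseteq> M" "\<And>e. e \<in> E \<Longrightarrow> e \<subseteq> S" unfolding E_def doubled_def by auto
  have SV: "S \<subseteq> verts G" using dom by (simp add: dominating_set_def)
  have finC: "finite C" unfolding C_def by simp
  have PC: "P u \<subseteq> C" for u unfolding P_def private_nbrs_def C_def by blast
  have finP: "finite (P u)" for u using finite_subset[OF PC finC] .
  have finE: "finite E" unfolding E_def by (rule finite_doubled)
  have finW: "finite (\<Union>E)" using finE EM finite_edge by blast
  have QC: "Q \<subseteq> C" using PC unfolding Q_def by blast
  have "\<Union>E \<noteq> {}" using ne EM edge_nonempty unfolding E_def[symmetric] by blast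
  then obtain u where u: "u \<in> \<Union>E" and umin: "\<And>x. x \<in> \<Union>E \<Longrightarrow> card (P u) \<le> card (P x)"
    using ex_min_if_finite[of "(\<lambda>x. card (P x)) ` \<Union>E"] finW
    by (smt (verit) finite_imageI image_iff image_is_empty not_less)
  let ?p = "card (P u)"
  have "P u \<noteq> {}"
  proof -
    obtain e where e: "e \<in> E" "u \<in> e" using u by blast
    then obtain w where w: "e = {u, w}" "u \<noteq> w" "u \<rightarrow> w" using EM by (metis matching_edgeE subsetD)
    then have "u \<in> S" "w \<in> S" using e EM by auto
    then show ?thesis unfolding P_def using private_nbrs_nonempty[OF dom min] w by blast
  qed
  then have p: "?p \<ge> 1" using finP by (simp add: Suc_le_eq card_gt_0_iff)
  have cW: "card (\<Union>E) = 2 * card E"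
  proof -
    have "card (\<Union>E) = (\<Sum>e\<in>E. card e)"
      using EM indep finite_edge unfolding independent_edges_def
      by (intro card_Union_disjoint) (auto intro: pairwise_subset)
    also have "\<dots> = (\<Sum>e\<in>E. 2)" using EM card_edge by (intro sum.cong) auto
    finally show ?thesis by simp
  qed
  \<comment> \<open>The sets \<open>P x\<close> are disjoint, since a private neighbour has only one
    neighbour in \<open>S\<close>.\<close>
  have cQ: "card Q \<ge> 2 * card E * ?p"
  proof -
    have "2 * card E * ?p = (\<Sum>x\<in>\<Union>E. ?p)" by (simp add: cW)
    also have "\<dots> \<le> (\<Sum>x\<in>\<Union>E. card (P x))" using umin by (rule sum_mono)
    also have "\<dots> = card Q" unfolding Q_def
      using finW finP EM
      by (intro card_UN_disjoint[symmetric]) (auto simp: P_def private_nbrs_def)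
    finally show ?thesis .
  qed
  have sumC: "(\<Sum>v\<in>C. f v) + card Q = 2 * card C"
  proof -
    have "(\<Sum>v\<in>C. f v) = (\<Sum>v\<in>Q. f v) + (\<Sum>v\<in>C - Q. f v)"
      using sum.subset_diff[OF QC finC, of f] by simp
    also have "\<dots> = card Q + 2 * card (C - Q)" by (simp add: f_def)
    finally show ?thesis
      using card_Diff_subset[OF finite_subset[OF QC finC] QC] card_mono[OF finC QC] by simp
  qed
  have edge_sum: "2 \<le> (\<Sum>v\<in>e \<inter> C. f v)" if "e \<in> N" for e
  proof -
    have eM: "e \<in> M" "e \<notin> E" using that unfolding N_def by auto
    then have "\<not> e \<subseteq> S" unfolding E_def doubled_def by blast
    then obtain v where v: "v \<in> e" "v \<notin> S" by blast
    then obtain v' where v': "e = {v, v'}" "v \<noteq> v'" "v \<rightarrow> v'" "v \<in> verts G" "v' \<in> verts G"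
      by (metis eM(1) matching_edgeE)
    have fin: "finite (e \<inter> C)" using finC by simp
    show ?thesis
    proof (cases "v \<in> Q")
      case True
      then obtain x where x: "x \<in> \<Union>E" "v \<in> P x" unfolding Q_def by blast
      have "v' \<notin> S"
      proof
        assume "v' \<in> S"
        then have "v' = x" using x(2) v'(3) unfolding P_def private_nbrs_def by blast
        then obtain e' where "e' \<in> E" "v' \<in> e'" using x by blast
        then show False using matching_unique[OF eM(1), of e' v'] eM EM v' by blast
      qed
      then have "e \<inter> C = {v, v'}" using v v' unfolding C_def by blast
      then show ?thesis using v'(2) by (simp add: f_def)
    next
      case False
      then have "2 = f v" by (simp add: f_def)
      also have "\<dots> \<le> (\<Sum>v\<in>e \<inter> C. f v)"
        using fin v v' by (intro member_le_sum) (auto simp: C_def)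
      finally show ?thesis .
    qed
  qed
  have "2 * card N = (\<Sum>e\<in>N. 2)" by simp
  also have "\<dots> \<le> (\<Sum>e\<in>N. \<Sum>v\<in>e \<inter> C. f v)" using edge_sum by (rule sum_mono)
  also have "\<dots> = (\<Sum>v\<in>(\<Union>e\<in>N. e \<inter> C). f v)"
    using finite_matching finC matching_unique unfolding N_def
    by (intro sum.UNION_disjoint[symmetric]) auto
  also have "\<dots> \<le> (\<Sum>v\<in>C. f v)" using finC by (intro sum_mono2) auto
  finally have "2 * card N + 2 * card E * ?p \<le> 2 * card C" using sumC cQ by linarith
  then have 1: "card N + card E * ?p \<le> card C" by simp
  have 2: "card M = card E + card N"
    using card_Diff_subset[OF finE EM(1)] card_mono[OF finite_matching EM(1)]
    unfolding N_def by simp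
  have "card E \<ge> 1" using ne finE unfolding E_def by (simp add: Suc_le_eq card_gt_0_iff)
  \<comment> \<open>Over the integers this is
    \<open>(card E - 1) * (card (P u) - 1) \<ge> 0\<close>.\<close>
  then have 3: "card E + ?p \<le> card E * ?p + 1"
    using p by (cases "card E"; cases ?p) auto
  have "card C + card S = card (verts G)"
    using card_Diff_subset[OF finite_subset_verts[OF SV] SV] card_mono[OF finite_verts SV] unfolding C_def by simp
  then show ?thesis using 1 2 3 u unfolding E_def P_def by (intro bexI[of _ u]) linarith+
qed

text \<open>The bound leaves room for all private neighbours of \<open>u\<close>, but only a maximal
  part \<open>R\<close> free of matching edges is added, so that no new doubled edge appears.
  Dropping \<open>u\<close> then undoes the edge \<open>e\<close>.\<close>

lemma reconf_fewer_doubled: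
  assumes dom: "dominating_set G S" and u: "u \<in> \<Union>(doubled S)"
    and k: "card S + card (private_nbrs G S u) \<le> k"
  shows "\<exists>S'. dominating_set G S' \<and> card S' \<le> k \<and> reconf G k S S' \<and>
    card (doubled S') < card (doubled S)"
proof -
  obtain e where e: "e \<in> M" "e \<subseteq> S" "u \<in> e" using u unfolding doubled_def by blast
  then obtain w where w: "e = {u, w}" "u \<noteq> w" "u \<rightarrow> w" by (metis matching_edgeE)
  have uw: "u \<in> S" "w \<in> S" using e w by auto
  have SV: "S \<subseteq> verts G" using dom by (simp add: dominating_set_def)
  define P where "P = private_nbrs G S u"
  have PV: "P \<subseteq> verts G" "P \<inter> S = {}" unfolding P_def private_nbrs_def by auto
  have finP: "finite P" using PV(1) by (rule finite_subset_verts)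
  define Rs where "Rs = {R. R \<subseteq> P \<and> doubled R = {}}"
  have "doubled {} = {}" using edge_nonempty unfolding doubled_def by blast
  then have "{} \<in> Rs" unfolding Rs_def by simp
  moreover have "finite Rs" using finP unfolding Rs_def by simp
  ultimately obtain R where R: "R \<in> Rs" "\<And>R'. R' \<in> Rs \<Longrightarrow> R \<subseteq> R' \<Longrightarrow> R = R'"
    using finite_has_maximal[of Rs] by blast
  define S' where "S' = (S \<union> R) - {u}"
  have RP: "R \<subseteq> P" and dR: "doubled R = {}" using R(1) unfolding Rs_def by auto
  have dom': "dominating_set G S'"
    unfolding dominating_set_def
  proof (intro conjI ballI)
    show "S' \<subseteq> verts G" using SV RP PV unfolding S'_def by blast
    fix v assume v: "v \<in> verts G - S'"
    \<comment> \<open>\<open>u\<close> is dominated by its partner \<open>w\<close>, a vertex that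
      is not private by another member of \<open>S\<close>, and a private neighbour outside
      \<open>R\<close>, by maximality, by its partner in \<open>R\<close>.\<close>
    consider "v = u" | "v \<notin> S" "v \<notin> P" | "v \<in> P" "v \<notin> R"
      using v unfolding S'_def by blast
    then show "\<exists>x\<in>S'. v \<rightarrow> x"
    proof cases
      case 1
      then show ?thesis using w uw unfolding S'_def by blast
    next
      case 2
      then show ?thesis
        using v dom unfolding S'_def P_def private_nbrs_def dominating_set_def by blast
    next
      case 3
      then have "insert v R \<notin> Rs" using R(2)[of "insert v R"] by blast
      then obtain f where f: "f \<in> M" "f \<subseteq> insert v R" using RP 3 unfolding Rs_def doubled_def by blast
      then have "v \<in> f" using dR unfolding doubled_def by blast
      then obtain y where y: "f = {v, y}" "v \<noteq> y" "v \<rightarrow> y" by (metis f(1) matching_edgeE)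
      then have "y \<in> R" using f by blast
      then have "y \<in> S'" using RP PV uw unfolding S'_def by blast
      then show ?thesis using y by blast
    qed
  qed
  have SRV: "S \<union> R \<subseteq> verts G" using SV RP PV by blast
  have "card (S \<union> R) \<le> card S + card R" by (rule card_Un_le)
  also have "\<dots> \<le> k" using card_mono[OF finP RP] k unfolding P_def by linarith
  finally have cSR: "card (S \<union> R) \<le> k" .
  have "reconf G k S (S \<union> R)" using dom SRV cSR by (intro reconf_superset) auto
  moreover have "reconf G k S' (S \<union> R)"
    using dom' SRV cSR by (intro reconf_superset) (auto simp: S'_def)
  ultimately have "reconf G k S S'" using reconf_trans reconf_sym by meson
  moreover have "card S' \<le> k"
    using card_mono[of "S \<union> R" S'] cSR finite_subset_verts[OF SRV] unfolding S'_def by force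
  moreover have "doubled S' \<subset> doubled S"
  proof
    \<comment> \<open>An endpoint of \<open>f\<close> outside \<open>S\<close> lies in
      \<open>R\<close>, and its only neighbour in \<open>S\<close> is the removed \<open>u\<close>.
      So the other endpoint lies in \<open>R\<close> too, which contains no matching edge.\<close>
    have "f \<subseteq> S" if f: "f \<in> M" "f \<subseteq> S'" for f
    proof (rule ccontr)
      assume "\<not> f \<subseteq> S"
      then obtain x where x: "x \<in> f" "x \<notin> S" by blast
      then obtain y where y: "f = {x, y}" "x \<noteq> y" "x \<rightarrow> y" by (metis f(1) matching_edgeE)
      have xR: "x \<in> R" "y \<in> S'" using x f y unfolding S'_def by auto
      then have "y \<notin> S" using RP y unfolding P_def private_nbrs_def S'_def by blast
      then have "f \<subseteq> R" using xR y unfolding S'_def by blast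
      then show False using dR f unfolding doubled_def by blast
    qed
    then show "doubled S' \<subseteq> doubled S" unfolding doubled_def by blast
    show "doubled S' \<noteq> doubled S" using e unfolding doubled_def S'_def by blast
  qed
  ultimately show ?thesis using dom' finite_doubled psubset_card_mono by blast
qed

section \<open>Connectivity of the dominating graph\<close>

lemma ex_minimal_dominating_subset:
  assumes "dominating_set G S"
  obtains S0 where "S0 \<subseteq> S" "dominating_set G S0" "\<And>u. u \<in> S0 \<Longrightarrow> \<not> dominating_set G (S0 - {u})"
proof -
  have "finite S" using assms finite_subset_verts unfolding dominating_set_def by blast
  then have "finite {X. X \<subseteq> S \<and> dominating_set G X}" by simp
  moreover have "S \<in> {X. X \<subseteq> S \<and> dominating_set G X}" using assms by simp
  ultimately obtain S0 where S0: "S0 \<in> {X. X \<subseteq> S \<and> dominating_set G X}"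
    and min: "\<And>X. X \<in> {X. X \<subseteq> S \<and> dominating_set G X} \<Longrightarrow> X \<subseteq> S0 \<Longrightarrow> S0 = X"
    using finite_has_minimal by (metis (no_types, lifting) empty_iff)
  show thesis
  proof (rule that)
    show "S0 \<subseteq> S" "dominating_set G S0" using S0 by auto
    show "\<not> dominating_set G (S0 - {u})" if "u \<in> S0" for u
      using min[of "S0 - {u}"] S0 that by blast
  qed
qed

text \<open>Induction on the number of doubled edges, first shrinking to a minimal dominating set so
  that private neighbours can be counted.\<close>

lemma reconf_to_transversal_complement:
  assumes "dominating_set G S" "card S \<le> k"
    and T: "T \<subseteq> \<Union>M" "\<And>e. e \<in> M \<Longrightarrow> \<exists>!x. x \<in> e \<inter> T"
    and k: "card (verts G) + 1 \<le> k + card M"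
  shows "reconf G k S (verts G - T)"
  using assms(1,2)
proof (induction "card (doubled S)" arbitrary: S rule: less_induct)
  case less
  obtain S0 where S0: "S0 \<subseteq> S" "dominating_set G S0"
    "\<And>u. u \<in> S0 \<Longrightarrow> \<not> dominating_set G (S0 - {u})"
    using ex_minimal_dominating_subset less.prems(1) by metis
  have SV: "S \<subseteq> verts G" using less.prems(1) by (simp add: dominating_set_def)
  have "reconf G k S S0"
    using S0 SV less.prems(2) by (intro reconf_sym[OF reconf_superset])
  moreover have "reconf G k S0 (verts G - T)"
  proof (cases "doubled S0 = {}")
    case True
    then show ?thesis
      using reconf_to_transversal_complement_if_not_doubled[OF S0(2) _ T k] by blast
  next
    case False
    then obtain u where u: "u \<in> \<Union>(doubled S0)"
      "card S0 + card (private_nbrs G S0 u) + card M \<le> card (verts G) + 1"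
      using ex_few_private_nbrs S0 by blast
    then have "card S0 + card (private_nbrs G S0 u) \<le> k" using k by linarith
    from reconf_fewer_doubled[OF S0(2) u(1) this] obtain S' where
      S': "dominating_set G S'" "card S' \<le> k" "reconf G k S0 S'"
        "card (doubled S') < card (doubled S0)" by blast
    \<comment> \<open>Shrinking creates no doubled edge, so the decrease from \<open>S0\<close> is
      also one from \<open>S\<close>.\<close>
    have "card (doubled S0) \<le> card (doubled S)"
      using card_mono[OF finite_doubled doubled_mono[OF S0(1)]] .
    then have "reconf G k S' (verts G - T)" using less.hyps S' by simp
    then show ?thesis using S' reconf_trans by blast
  qed
  ultimately show ?case using reconf_trans by blast
qed

lemma strongly_connected_k_dominating_graph:
  assumes k: "card (verts G) + 1 \<le> k + card M"
  shows "strongly_connected (with_proj (k_dominating_graph k G))"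
proof -
  have "\<forall>e\<in>M. \<exists>x. x \<in> e" using edge_nonempty by blast
  then obtain f where f: "\<forall>e\<in>M. f e \<in> e" by metis
  define T where "T = f ` M"
  have T1: "T \<subseteq> \<Union>M" using f unfolding T_def by blast
  have T2: "\<exists>!x. x \<in> e \<inter> T" if "e \<in> M" for e
    using f that matching_unique unfolding T_def by (intro ex1I[of _ "f e"]) blast+
  \<comment> \<open>Strong connectivity demands a nonempty vertex set; the common target
    \<open>verts G - T\<close> is itself a vertex.\<close>
  have "doubled (verts G - T) = {}" using T2 unfolding doubled_def by blast
  from card_if_not_doubled[OF _ this] have "card (verts G - T) \<le> k" using k by simp
  moreover have "dominating_set G (verts G - T)"
    unfolding dominating_set_def
  proof (intro conjI ballI)
    fix v assume "v \<in> verts G - (verts G - T)"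
    then have "v \<in> T" by blast
    then obtain e where e: "e \<in> M" "v \<in> e" using T1 by blast
    then obtain w where w: "e = {v, w}" "v \<noteq> w" "v \<rightarrow> w" "w \<in> verts G" by (metis matching_edgeE)
    then have "w \<notin> T" using T2[OF e(1)] \<open>v \<in> T\<close> by blast
    then show "\<exists>u\<in>verts G - T. v \<rightarrow> u" using w by blast
  qed blast
  ultimately have "verts (with_proj (k_dominating_graph k G)) \<noteq> {}"
    by (auto simp: k_dominating_graph_def)
  then show ?thesis
  proof (rule strongly_connectedI)
    fix A B
    assume "A \<in> verts (with_proj (k_dominating_graph k G))"
      and "B \<in> verts (with_proj (k_dominating_graph k G))"
    then have "reconf G k A (verts G - T)" "reconf G k B (verts G - T)"
      using reconf_to_transversal_complement T1 T2 k by (auto simp: k_dominating_graph_def)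
    then show "reconf G k A B" using reconf_trans reconf_sym by meson
  qed
qed

end

theorem theorem1:
  fixes G :: "('a, 'b) pre_digraph" and m n :: nat and M :: "'a set set"
  assumes "graph G"
    and "card (verts G) = n"
    and "independent_edges G M" and "card M \<ge> m + 1"
  shows "Digraph_Component.connected (with_proj (k_dominating_graph (n - m) G))"
proof -
  interpret matched_graph G M
    using assms(1,3) by (simp add: matched_graph_def matched_graph_axioms_def)
  interpret D: pair_graph "k_dominating_graph (n - m) G"
    by (rule pair_graph_k_dominating_graph) (rule assms(1))
  \<comment> \<open>Counting with the empty set gives \<open>card M \<le> n\<close>, hence
    \<open>m < n\<close>, so \<open>n - m\<close> is an exact difference.\<close>
  have "doubled {} = {}" using edge_nonempty unfolding doubled_def by blast
  from card_if_not_doubled[OF _ this] have "card M \<le> n" using assms(2) by simp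
  then have "strongly_connected (with_proj (k_dominating_graph (n - m) G))"
    using assms(2,4) by (intro strongly_connected_k_dominating_graph) linarith
  then show ?thesis by (rule D.strongly_connected_imp_connected[OF D.sym_arcs])
qed

end
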